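(* Let $\kappa$ be an infinite regular cardinal that does not have the tree property. Then there is a $\mathcal{P}_{<\kappa}$-ghost at $\kappa$.
   Context: Work in ZFC. $0$ is deemed a limit ordinal. $\mathcal{P}_{<\kappa}X$ is the set of subsets of $X$ of cardinality $<\kappa$, a functor on $\mathbf{Set}$ via direct image. Final chain of an endofunctor $F$ on $\mathbf{Set}$: sets $\nu^{(i)}F$ for all ordinals $i$, with functorial connecting maps $\nu^{(i\geqslant j)}:\nu^{(i)}F\to\nu^{(j)}F$ for $j\leqslant i$, determined by: $\nu^{(i+1)}F=F\nu^{(i)}F$ and $\nu^{(i+1\geqslant j+1)}=F\nu^{(i\geqslant j)}$; for $i$ a limit, $\nu^{(i)}F$ is the set of families $(x_j)_{j<i}$ with $x_j\in\nu^{(j)}F$ and $\nu^{(j\geqslant k)}x_j=x_k$ for $k\leqslant j<i$, and $\nu^{(i\geqslant j)}x=x_j$ for $j<i$. So $\nu^{(0)}F=\{()\}$. Let $0_{i+1}=\emptyset$ and $0_i=(0_j)_{j<i}$ for $i$ a limit; these are elements of $\nu^{(i)}\mathcal{P}_{<\kappa}$. For a transition system (set with binary relation $\rightsquigarrow$; $y$ is a successor of $x$ if $x\rightsquigarrow y$) in which every element has $<\kappa$ successors, and an element $x$ of it, define $p_i x\in\nu^{(i)}\mathcal{P}_{<\kappa}$ by $p_{i+1}x=\{p_i y\mid x\rightsquigarrow y\}$ and $p_i x=(p_j x)_{j<i}$ for $i$ a limit. An element of $\nu^{(i)}\mathcal{P}_{<\kappa}$ is $\mathcal{P}_{<\kappa}$-coalgebraic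 when it equals $p_i x$ for some such $x$. For $i$ a limit, $a\in\nu^{(i)}\mathcal{P}_{<\kappa}$ is $\mathcal{P}_{<\kappa}$-Cauchy when every component $a_j$ ($j<i$) is $\mathcal{P}_{<\kappa}$-coalgebraic. For a limit $i$ and $a,b\in\nu^{(i)}\mathcal{P}_{<\kappa}$, $b$ is a successor of $a$ when $b_j\in a_{j+1}$ for all $j<i$. A $\mathcal{P}_{<\kappa}$-ghost at a limit $i$ is a $\mathcal{P}_{<\kappa}$-Cauchy element of $\nu^{(i)}\mathcal{P}_{<\kappa}$, distinct from $0_i$, that has no successor. A tidy $\lambda$-tree is a functor $D:\lambda^{\mathrm{op}}\to\mathbf{Set}$ (levels $D_i$, connecting maps $D_i\to D_j$ for $j\leqslant i<\lambda$) such that all connecting maps are surjective, for each limit $i<\lambda$ every full branch of $(D_j)_{j<i}$ has at most one extension to a full branch of $(D_j)_{j\leqslant i}$, and $D_0$ is a singleton; a full branch is a compatible family $(x_i)_i$ with $x_i\in D_i$. A regular infinite cardinal $\lambda$ has the tree property when every tidy $\lambda$-tree with all levels of size $<\lambda$ has a full branch. *)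

theory Defs
  imports Main
begin

unbundle cardinal_syntax

text \<open>
  Ordinals are the elements of an arbitrary type \<open>'o\<close> of class \<^class>\<open>wellorder\<close>; the ordinal
  \<open>i :: 'o\<close> is the order type of \<open>{..<i}\<close>.  Every ordinal is of this form for some \<open>'o\<close>.
\<close>

section \<open>Ordinals\<close>

definition limit_ord :: "'o::wellorder \<Rightarrow> bool" where
  "limit_ord i \<longleftrightarrow> (\<forall>j<i. \<exists>k. j < k \<and> k < i)"

text \<open>The least element, the ordinal 0, satisfies \<^const>\<open>limit_ord\<close>.\<close>

definition pred_ord :: "'o::wellorder \<Rightarrow> 'o" where
  "pred_ord i = (GREATEST j. j < i)"

definition succ_ord :: "'o::wellorder \<Rightarrow> 'o" where
  "succ_ord j = (LEAST k. j < k)"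

definition ord_rel :: "'o::wellorder \<Rightarrow> 'o rel" where
  "ord_rel i = {(x, y). x \<le> y \<and> y < i}"

lemma pred_ord:
  assumes "\<not> limit_ord i"
  shows "pred_ord i < i" "k < i \<Longrightarrow> k \<le> pred_ord i"
proof -
  from assms obtain j where j: "j < i" "\<And>k. k < i \<Longrightarrow> k \<le> j"
    unfolding limit_ord_def by (meson not_le)
  have "pred_ord i = j"
    unfolding pred_ord_def using j by (intro Greatest_equality) auto
  with j show "pred_ord i < i" "k < i \<Longrightarrow> k \<le> pred_ord i" by auto
qed

lemma succ_ord:
  assumes "j < (i::'o::wellorder)"
  shows "j < succ_ord j" "succ_ord j \<le> i" "\<not> limit_ord (succ_ord j)" "pred_ord (succ_ord j) = j"
proof -
  show 1: "j < succ_ord j"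
    unfolding succ_ord_def using assms by (rule LeastI)
  show "succ_ord j \<le> i"
    unfolding succ_ord_def using assms by (rule Least_le)
  have 2: "k \<le> j" if "k < succ_ord j" for k
    using that unfolding succ_ord_def by (meson not_less_Least not_le)
  show "\<not> limit_ord (succ_ord j)"
    unfolding limit_ord_def using 1 2 by (meson not_le)
  show "pred_ord (succ_ord j) = j"
    unfolding pred_ord_def using 1 2 by (intro Greatest_equality) auto
qed

lemma Field_ord_rel: "Field (ord_rel i) = {..<i}"
  by (fastforce simp: Field_def ord_rel_def)

lemma ordLess_ord_rel_imp:
  fixes i :: "'o::wellorder"
  assumes "|A| <o ord_rel i"
  shows "|A| \<le>o |UNIV::'o set|"
proof -
  have "|A| \<le>o |Field (ord_rel i)|"
    using card_of_mono2[OF ordLess_imp_ordLeq[OF assms]] by (simp only: Field_card_of)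
  also have "|Field (ord_rel i)| \<le>o |UNIV::'o set|"
    by (rule card_of_mono1) simp
  finally show ?thesis .
qed

section \<open>A universe for the final chain\<close>

text \<open>
  The members of the final chain are hereditarily built from sets and from families indexed by
  ordinals.  The type \<open>'k elt\<close> contains every subset of \<open>'k elt\<close> of cardinality at most
  \<open>|UNIV :: 'k set|\<close> (via \<open>SetOf\<close>) and every partial family \<open>'k \<Rightarrow> 'k elt option\<close> (via \<open>Fam\<close>).
  It is obtained from trees by identifying set nodes with the same members.
\<close>

datatype 'k pre = PSet "'k \<Rightarrow> 'k pre option" | PFam "'k \<Rightarrow> 'k pre option"

inductive eqv :: "'k pre \<Rightarrow> 'k pre \<Rightarrow> bool" where
  eqv_PSet: "rel_set eqv (ran f) (ran g) \<Longrightarrow> eqv (PSet f) (PSet g)"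
| eqv_PFam: "rel_fun (=) (rel_option eqv) f g \<Longrightarrow> eqv (PFam f) (PFam g)"
monos rel_set_mono option.rel_mono rel_fun_mono

inductive_simps eqv_simps:
  "eqv (PSet f) y" "eqv (PFam f) y" "eqv x (PSet g)" "eqv x (PFam g)"

lemma eqv_refl: "eqv x x"
proof (induction x)
  case (PSet f)
  have "eqv y y" if "y \<in> ran f" for y
  proof -
    from that obtain k where "f k = Some y" by (auto simp: ran_def)
    then show ?thesis using PSet[of "f k" y] by (metis option.set_intros rangeI)
  qed
  then have "rel_set eqv (ran f) (ran f)" unfolding rel_set_def by blast
  then show ?case by (rule eqv_PSet)
next
  case (PFam f)
  have "rel_option eqv (f k) (f k)" for k
  proof (cases "f k")
    case (Some y)
    then have "eqv y y" using PFam[of "f k" y] by (metis option.set_intros rangeI)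
    with Some show ?thesis by simp
  qed simp
  then show ?case by (auto intro!: eqv_PFam simp: rel_fun_def)
qed

lemma eqv_sym: "eqv x y \<Longrightarrow> eqv y x"
proof (induction rule: eqv.induct)
  case (eqv_PSet f g)
  then show ?case by (intro eqv.eqv_PSet) (fastforce simp: rel_set_def)
next
  case (eqv_PFam f g)
  show ?case
  proof (intro eqv.eqv_PFam rel_funI)
    fix k l :: 'a assume "k = l"
    with eqv_PFam have "rel_option (\<lambda>x y. eqv x y \<and> eqv y x) (f l) (g k)"
      by (auto simp: rel_fun_def)
    then show "rel_option eqv (g k) (f l)"
      by (cases "f l"; cases "g k") auto
  qed
qed

lemma eqv_trans: "eqv x y \<Longrightarrow> eqv y z \<Longrightarrow> eqv x z"
proof (induction arbitrary: z rule: eqv.induct)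
  case (eqv_PSet f g)
  from eqv_PSet(2) obtain h where z: "z = PSet h" and gh: "rel_set eqv (ran g) (ran h)"
    by (auto simp: eqv_simps(1))
  let ?R = "\<lambda>x y. eqv x y \<and> (\<forall>z. eqv y z \<longrightarrow> eqv x z)"
  have fg: "rel_set ?R (ran f) (ran g)" by (rule eqv_PSet(1))
  have "rel_set (?R OO eqv) (ran f) (ran h)"
    unfolding rel_set_OO[symmetric] using fg gh by (rule relcomppI)
  moreover have "?R OO eqv \<le> eqv" by auto
  ultimately have "rel_set eqv (ran f) (ran h)"
    by (blast dest: rel_set_mono)
  then show ?case unfolding z by (rule eqv.eqv_PSet)
next
  case (eqv_PFam f g)
  from eqv_PFam(2) obtain h where z: "z = PFam h" and gh: "rel_fun (=) (rel_option eqv) g h"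
    by (auto simp: eqv_simps(2))
  let ?R = "\<lambda>x y. eqv x y \<and> (\<forall>z. eqv y z \<longrightarrow> eqv x z)"
  have fg: "rel_fun (=) (rel_option ?R) f g" by (rule eqv_PFam(1))
  have "rel_option eqv (f k) (h k)" for k
  proof -
    have "rel_option ?R (f k) (g k)" "rel_option eqv (g k) (h k)"
      using fg gh by (simp_all add: rel_fun_def)
    then show ?thesis by (cases "f k"; cases "g k"; cases "h k") simp_all
  qed
  then have "rel_fun (=) (rel_option eqv) f h" by (simp add: rel_fun_def)
  then show ?case unfolding z by (rule eqv.eqv_PFam)
qed

quotient_type 'k elt = "'k pre" / eqv
  by (intro equivpI reflpI sympI transpI) (blast intro: eqv_refl eqv_sym eqv_trans)+

lemma ran_parametric:
  includes lifting_syntax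
  shows "(((=) ===> rel_option R) ===> rel_set R) ran ran"
proof (rule rel_funI)
  fix f g
  assume "((=) ===> rel_option R) f g"
  then have fg: "rel_option R (f k) (g k)" for k by (simp add: rel_fun_def)
  show "rel_set R (ran f) (ran g)"
  proof (rule rel_setI)
    fix x assume "x \<in> ran f"
    then obtain k where "f k = Some x" by (auto simp: ran_def)
    then show "\<exists>y\<in>ran g. R x y"
      using fg[of k] by (auto simp: option_rel_Some1 intro: ranI)
  next
    fix y assume "y \<in> ran g"
    then obtain k where "g k = Some y" by (auto simp: ran_def)
    then show "\<exists>x\<in>ran f. R x y"
      using fg[of k] by (auto simp: option_rel_Some2 intro: ranI)
  qed
qed

lift_definition Fam :: "('k \<Rightarrow> 'k elt option) \<Rightarrow> 'k elt" is PFam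
  by (rule eqv_PFam) (auto simp: rel_fun_def)

lift_definition EnumSet :: "('k \<Rightarrow> 'k elt option) \<Rightarrow> 'k elt" is PSet
  by (rule eqv_PSet) (use ran_parametric[of eqv] in \<open>auto simp: rel_fun_def\<close>)

lift_definition component_option :: "'k elt \<Rightarrow> 'k \<Rightarrow> 'k elt option" is
  "\<lambda>x. case x of PFam f \<Rightarrow> f | PSet f \<Rightarrow> (\<lambda>_. None)"
  by (auto elim!: eqv.cases simp: rel_fun_def)

lift_definition elems :: "'k elt \<Rightarrow> 'k elt set" is
  "\<lambda>x. case x of PSet f \<Rightarrow> ran f | PFam f \<Rightarrow> {}"
  by (auto elim!: eqv.cases simp: rel_set_def)

definition component :: "'k elt \<Rightarrow> 'k \<Rightarrow> 'k elt" where
  "component x j = the (component_option x j)"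

definition SetOf :: "'k elt set \<Rightarrow> 'k elt" where
  "SetOf A = EnumSet (SOME f. ran f = A)"

lemma abs_rep_elt: "abs_elt (rep_elt x) = x"
  by (rule Quotient_abs_rep[OF Quotient_elt])

lemma component_option_Fam [simp]: "component_option (Fam f) = f"
proof
  fix k
  show "component_option (Fam f) k = f k"
    by (cases "f k") (simp_all add: Fam_def component_option.abs_eq abs_rep_elt)
qed

lemma component_Fam [simp]: "component (Fam f) j = the (f j)"
  by (simp add: component_def)

lemma elems_EnumSet: "elems (EnumSet f) = ran f"
proof -
  have "elems (EnumSet f) = abs_elt ` ran (\<lambda>k. map_option rep_elt (f k))"
    by (simp add: EnumSet_def elems.abs_eq comp_def map_fun_def)
  also have "\<dots> = ran f"
    by (force simp: ran_def abs_rep_elt)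
  finally show ?thesis .
qed

lemma elems_SetOf:
  fixes A :: "'k elt set"
  assumes "|A| \<le>o |UNIV :: 'k set|"
  shows "elems (SetOf A) = A"
proof -
  from assms obtain e :: "'k elt \<Rightarrow> 'k" where e: "inj_on e A"
    by (auto simp: card_of_ordLeq[symmetric])
  have "ran (\<lambda>k. if k \<in> e ` A then Some (inv_into A e k) else None) = A"
    using e by (auto simp: ran_def) (metis imageI inv_into_f_f)
  then have "ran (SOME f :: 'k \<Rightarrow> 'k elt option. ran f = A) = A"
    by (rule someI[where P = "\<lambda>f. ran f = A"])
  then show ?thesis by (simp add: SetOf_def elems_EnumSet)
qed

section \<open>The final chain\<close>

text \<open>
  \<open>nu \<kappa> i\<close> is the \<open>i\<close>-th stage of the final chain of \<open>\<P>\<^bsub><\<kappa>\<^esub>\<close>, and \<open>conn i j\<close> is the connecting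
  map from stage \<open>i\<close> to stage \<open>j \<le> i\<close>.  The clause for limit \<open>j\<close> below a successor \<open>i\<close> is forced by functoriality:
  for \<open>k < j\<close>, the \<open>k\<close>-component of the image at \<open>j\<close> is the image at \<open>k\<close>.
\<close>

function conn :: "'o::wellorder \<Rightarrow> 'o \<Rightarrow> 'o elt \<Rightarrow> 'o elt" where
  "conn i j x =
    (if i = j then x
     else if limit_ord i then component x j
     else if limit_ord j then Fam (\<lambda>k. if k < j then Some (conn i k x) else None)
     else SetOf ((\<lambda>y. conn (pred_ord i) (pred_ord j) y) ` elems x))"
  by auto
termination
  by (relation "inv_image ({(x, y). x < y} <*lex*> {(x, y). x < y}) (\<lambda>(i, j, x). (i, j))")
    (auto simp: pred_ord intro!: wf_inv_image wf_lex_prod wf)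

declare conn.simps [simp del]

definition Pow_less :: "'o::wellorder \<Rightarrow> 'a set \<Rightarrow> 'a set set" where
  "Pow_less \<kappa> X = {A. A \<subseteq> X \<and> |A| <o ord_rel \<kappa>}"

function nu :: "'o::wellorder \<Rightarrow> 'o \<Rightarrow> 'o elt set" where
  "nu \<kappa> i =
    (if limit_ord i then
       {Fam f |f. dom f = {..<i} \<and> (\<forall>j<i. the (f j) \<in> nu \<kappa> j) \<and>
                  (\<forall>j<i. \<forall>k\<le>j. conn j k (the (f j)) = the (f k))}
     else SetOf ` Pow_less \<kappa> (nu \<kappa> (pred_ord i)))"
  by auto
termination
  by (relation "inv_image {(x, y). x < y} snd") (auto simp: pred_ord wf)

declare nu.simps [simp del]

function zero_elt :: "'o::wellorder \<Rightarrow> 'o elt" where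
  "zero_elt i =
    (if limit_ord i then Fam (\<lambda>j. if j < i then Some (zero_elt j) else None) else SetOf {})"
  by auto
termination
  by (relation "{(x, y). x < y}") (auto simp: wf)

declare zero_elt.simps [simp del]

section \<open>Coalgebraic elements and ghosts\<close>

text \<open>\<open>beh R i x\<close> is the element \<open>p\<^sub>i x\<close> for the transition relation \<open>R\<close>.\<close>

function beh :: "'s rel \<Rightarrow> 'o::wellorder \<Rightarrow> 's \<Rightarrow> 'o elt" where
  "beh R i x =
    (if limit_ord i then Fam (\<lambda>j. if j < i then Some (beh R j x) else None)
     else SetOf ((\<lambda>y. beh R (pred_ord i) y) ` (R `` {x})))"
  by auto
termination
  by (relation "inv_image {(x, y). x < y} (\<lambda>(R, i, x). i)") (auto simp: pred_ord wf)

declare beh.simps [simp del]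

definition branching_less :: "'o::wellorder \<Rightarrow> 's rel \<Rightarrow> bool" where
  "branching_less \<kappa> R \<longleftrightarrow> (\<forall>x. |R `` {x}| <o ord_rel \<kappa>)"

text \<open>
  The transition systems range over relations on \<open>'o\<close>.  This is no restriction: the part of a
  system that is reachable from a given element has at most \<open>\<kappa>\<close> elements; see
  \<open>coalgebraic_beh\<close> below.
\<close>

definition coalgebraic :: "'o::wellorder \<Rightarrow> 'o \<Rightarrow> 'o elt \<Rightarrow> bool" where
  "coalgebraic \<kappa> i a \<longleftrightarrow>
    a \<in> nu \<kappa> i \<and> (\<exists>(R :: 'o rel) x. branching_less \<kappa> R \<and> a = beh R i x)"

definition Cauchy_elt :: "'o::wellorder \<Rightarrow> 'o \<Rightarrow> 'o elt \<Rightarrow> bool" where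
  "Cauchy_elt \<kappa> i a \<longleftrightarrow>
    limit_ord i \<and> a \<in> nu \<kappa> i \<and> (\<forall>j<i. coalgebraic \<kappa> j (component a j))"

definition successor :: "'o::wellorder \<Rightarrow> 'o elt \<Rightarrow> 'o elt \<Rightarrow> bool" where
  "successor i a b \<longleftrightarrow> (\<forall>j<i. component b j \<in> elems (component a (succ_ord j)))"

definition ghost :: "'o::wellorder \<Rightarrow> 'o \<Rightarrow> 'o elt \<Rightarrow> bool" where
  "ghost \<kappa> i a \<longleftrightarrow>
    Cauchy_elt \<kappa> i a \<and> a \<noteq> zero_elt i \<and> \<not> (\<exists>b \<in> nu \<kappa> i. successor i a b)"

section \<open>Trees\<close>

definition full_branch ::
  "('o::wellorder \<Rightarrow> 't set) \<Rightarrow> ('o \<Rightarrow> 'o \<Rightarrow> 't \<Rightarrow> 't) \<Rightarrow> 'o set \<Rightarrow> ('o \<Rightarrow> 't) \<Rightarrow> bool" where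
  "full_branch D d I x \<longleftrightarrow>
    (\<forall>i\<in>I. x i \<in> D i) \<and> (\<forall>i\<in>I. \<forall>j\<in>I. j \<le> i \<longrightarrow> d i j (x i) = x j)"

definition tidy_tree ::
  "'o::wellorder \<Rightarrow> ('o \<Rightarrow> 't set) \<Rightarrow> ('o \<Rightarrow> 'o \<Rightarrow> 't \<Rightarrow> 't) \<Rightarrow> bool" where
  "tidy_tree \<kappa> D d \<longleftrightarrow>
    (\<forall>i<\<kappa>. \<forall>x\<in>D i. d i i x = x) \<and>
    (\<forall>i<\<kappa>. \<forall>j\<le>i. \<forall>k\<le>j. \<forall>x\<in>D i. d j k (d i j x) = d i k x) \<and>
    (\<forall>i<\<kappa>. \<forall>j\<le>i. d i j ` D i = D j) \<and>
    (\<forall>i<\<kappa>. limit_ord i \<longrightarrow>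
      (\<forall>x. full_branch D d {..<i} x \<longrightarrow> (\<exists>\<^sub>\<le>\<^sub>1 y. full_branch D d {..i} (x(i := y))))) \<and>
    is_singleton (D (LEAST i. True))"

text \<open>
  A level of size \<open>< \<kappa>\<close> is equipotent to a subset of \<open>'o\<close>, so trees with levels in \<open>'o\<close>
  suffice; see \<open>tree_property_full_branch\<close> below.
\<close>

definition tree_property :: "'o::wellorder \<Rightarrow> bool" where
  "tree_property \<kappa> \<longleftrightarrow>
    (\<forall>(D :: 'o \<Rightarrow> 'o set) d.
      tidy_tree \<kappa> D d \<and> (\<forall>i<\<kappa>. |D i| <o ord_rel \<kappa>) \<longrightarrow>
      (\<exists>x. full_branch D d {..<\<kappa>} x))"

section \<open>Basic properties of the definitions\<close>

lemma Pow_less_image: "A \<in> Pow_less \<kappa> X \<Longrightarrow> f ` X \<subseteq> Y \<Longrightarrow> f ` A \<in> Pow_less \<kappa> Y"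
  unfolding Pow_less_def by (auto intro: ordLeq_ordLess_trans[OF card_of_image])

lemma elems_SetOf_Pow_less: "A \<in> Pow_less (\<kappa>::'o::wellorder) X \<Longrightarrow> elems (SetOf A :: 'o elt) = A"
  unfolding Pow_less_def by (rule elems_SetOf, rule ordLess_ord_rel_imp[of _ \<kappa>]) simp

lemma conn_same [simp]: "conn i i x = x"
  by (simp add: conn.simps)

lemma conn_limit: "limit_ord i \<Longrightarrow> j < i \<Longrightarrow> conn i j x = component x j"
  by (subst conn.simps) auto

lemma conn_to_limit:
  "\<not> limit_ord i \<Longrightarrow> limit_ord j \<Longrightarrow>
    conn i j x = Fam (\<lambda>k. if k < j then Some (conn i k x) else None)"
  by (subst conn.simps) auto

lemma nu_succE:
  assumes "\<not> limit_ord i" "x \<in> nu \<kappa> i"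
  obtains A where "A \<in> Pow_less \<kappa> (nu \<kappa> (pred_ord i))" "x = SetOf A"
    "elems x = A"
  using assms by (subst (asm) nu.simps) (auto simp: elems_SetOf_Pow_less)

lemma Fam_in_nu:
  assumes "limit_ord i" "\<And>j. j < i \<Longrightarrow> g j \<in> nu \<kappa> j"
    "\<And>j k. j < i \<Longrightarrow> k \<le> j \<Longrightarrow> conn j k (g j) = g k"
  shows "Fam (\<lambda>j. if j < i then Some (g j) else None) \<in> nu \<kappa> i"
proof -
  let ?f = "\<lambda>j. if j < i then Some (g j) else None"
  have the_f: "the (?f j) = g j" if "j < i" for j using that by simp
  have "dom ?f = {..<i}" by (auto split: if_splits)
  moreover have "\<forall>j<i. the (?f j) \<in> nu \<kappa> j" using assms(2) by simp
  moreover have "\<forall>j<i. \<forall>k\<le>j. conn j k (the (?f j)) = the (?f k)"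
    using assms(3) the_f by (metis le_less_trans)
  ultimately show ?thesis
    using assms(1) by (subst nu.simps) (simp only: if_True, blast)
qed

lemma SetOf_in_nu:
  "\<not> limit_ord i \<Longrightarrow> A \<in> Pow_less \<kappa> (nu \<kappa> (pred_ord i)) \<Longrightarrow> SetOf A \<in> nu \<kappa> i"
  by (subst nu.simps) auto

lemma conn_succ:
  assumes "\<not> limit_ord i" "\<not> limit_ord j" "x \<in> nu \<kappa> i"
  shows "conn i j x = SetOf (conn (pred_ord i) (pred_ord j) ` elems x)"
proof (cases "i = j")
  case True
  from assms(1,3) show ?thesis by (rule nu_succE) (simp add: True)
qed (use assms in \<open>subst conn.simps, auto\<close>)

theorem conn_functorial:
  assumes "x \<in> nu \<kappa> i" "j \<le> i"
  shows "conn i j x \<in> nu \<kappa> j \<and> (\<forall>k\<le>j. conn j k (conn i j x) = conn i k x)"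
  using assms
proof (induction i arbitrary: j x rule: less_induct)
  case (less i)
  show ?case
  proof (cases "j = i \<or> limit_ord i")
    case True
    then show ?thesis
    proof
      assume "limit_ord i"
      show ?thesis
      proof (cases "j = i")
        case False
        with less.prems have "j < i" by simp
        from \<open>limit_ord i\<close> less.prems(1) obtain f where f: "x = Fam f"
          "\<forall>j<i. the (f j) \<in> nu \<kappa> j"
          "\<forall>j<i. \<forall>k\<le>j. conn j k (the (f j)) = the (f k)"
          by (subst (asm) nu.simps) auto
        show ?thesis
          using f \<open>j < i\<close> \<open>limit_ord i\<close> by (auto simp: conn_limit)
      qed (use less.prems in simp)
    qed (use less.prems in simp)
  next
    case False
    then have "\<not> limit_ord i" "j < i" using less.prems by auto
    from \<open>j < i\<close> show ?thesis
    proof (induction j rule: less_induct)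
      case (less j)
      note inner = less.IH
      show ?case
      proof (cases "limit_ord j")
        case True
        let ?f = "\<lambda>k. if k < j then Some (conn i k x) else None"
        have eq: "conn i j x = Fam ?f"
          using \<open>\<not> limit_ord i\<close> True by (rule conn_to_limit)
        have k: "conn i k x \<in> nu \<kappa> k" "l \<le> k \<Longrightarrow> conn k l (conn i k x) = conn i l x"
          if "k < j" for k l using inner[of k] that less.prems by auto
        have "Fam ?f \<in> nu \<kappa> j"
          using True k by (rule Fam_in_nu)
        moreover have "conn j k (Fam ?f) = conn i k x" if "k \<le> j" for k
          using that True eq by (cases "k = j") (auto simp: conn_limit)
        ultimately show ?thesis unfolding eq by blast
      next
        case False
        from \<open>\<not> limit_ord i\<close> \<open>x \<in> nu \<kappa> i\<close> obtain A where
          A: "A \<in> Pow_less \<kappa> (nu \<kappa> (pred_ord i))" "elems x = A"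
          by (rule nu_succE)
        have pj: "pred_ord j \<le> pred_ord i"
          using pred_ord[OF False] pred_ord[OF \<open>\<not> limit_ord i\<close>] less.prems by auto
        have IH: "conn (pred_ord i) l y \<in> nu \<kappa> l \<and>
            (\<forall>k\<le>l. conn l k (conn (pred_ord i) l y) = conn (pred_ord i) k y)"
          if "y \<in> nu \<kappa> (pred_ord i)" "l \<le> pred_ord i" for l y
          using \<open>\<And>y j x. y < i \<Longrightarrow> x \<in> nu \<kappa> y \<Longrightarrow> j \<le> y \<Longrightarrow> conn y j x \<in> nu \<kappa> j \<and>
            (\<forall>k\<le>j. conn j k (conn y j x) = conn y k x)\<close> pred_ord(1)[OF \<open>\<not> limit_ord i\<close>] that
          by blast
        have B: "conn (pred_ord i) (pred_ord j) ` A \<in> Pow_less \<kappa> (nu \<kappa> (pred_ord j))"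
          using A(1) by (rule Pow_less_image) (use IH pj in auto)
        have eq: "conn i j x = SetOf (conn (pred_ord i) (pred_ord j) ` A)"
          using conn_succ[OF \<open>\<not> limit_ord i\<close> False \<open>x \<in> nu \<kappa> i\<close>] A by simp
        have in_nu: "conn i j x \<in> nu \<kappa> j"
          unfolding eq using False B by (rule SetOf_in_nu)
        have "conn j k (conn i j x) = conn i k x" if "k \<le> j" for k
          using that
        proof (induction k rule: less_induct)
          case (less k)
          show ?case
          proof (cases "limit_ord k")
            case True
            then have "(if l < k then Some (conn j l (conn i j x)) else None) =
                (if l < k then Some (conn i l x) else None)" for l
              using less by auto
            then show ?thesis
              using True False \<open>\<not> limit_ord i\<close> by (simp add: conn_to_limit)
          next
            case k: False
            have pk: "pred_ord k \<le> pred_ord j"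
              using pred_ord[OF False] pred_ord[OF k] less.prems by auto
            have "conn j k (conn i j x) =
                SetOf (conn (pred_ord j) (pred_ord k) ` conn (pred_ord i) (pred_ord j) ` A)"
              using conn_succ[OF False k in_nu] elems_SetOf_Pow_less[OF B] by (simp add: eq)
            also have "conn (pred_ord j) (pred_ord k) ` conn (pred_ord i) (pred_ord j) ` A =
                conn (pred_ord i) (pred_ord k) ` A"
              unfolding image_image using A(1) IH[OF _ pj] pk
              by (intro image_cong) (auto simp: Pow_less_def)
            also have "SetOf \<dots> = conn i k x"
              using conn_succ[OF \<open>\<not> limit_ord i\<close> k \<open>x \<in> nu \<kappa> i\<close>] A by simp
            finally show ?thesis .
          qed
        qed
        with in_nu show ?thesis by blast
      qed
    qed
  qed
qed

lemma zero_elt_in_nu: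
  assumes "|{} :: 'o::wellorder elt set| <o ord_rel \<kappa>"
  shows "zero_elt i \<in> nu \<kappa> (i::'o) \<and> (\<forall>k\<le>i. conn i k (zero_elt i) = zero_elt k)"
proof (induction i rule: less_induct)
  case (less i)
  have empty: "{} \<in> Pow_less \<kappa> (X :: 'o elt set)" for X
    using assms by (simp add: Pow_less_def)
  show ?case
  proof (cases "limit_ord i")
    case True
    let ?f = "\<lambda>j. if j < i then Some (zero_elt j) else None"
    have eq: "zero_elt i = Fam ?f" using True by (subst zero_elt.simps) simp
    have "zero_elt i \<in> nu \<kappa> i"
      unfolding eq using True less by (intro Fam_in_nu) auto
    moreover have "conn i k (zero_elt i) = zero_elt k" if "k \<le> i" for k
      using that True eq by (cases "k = i") (auto simp: conn_limit)
    ultimately show ?thesis by blast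
  next
    case False
    have eq: "zero_elt i = SetOf {}" using False by (subst zero_elt.simps) simp
    have in_nu: "zero_elt i \<in> nu \<kappa> i"
      unfolding eq using False empty by (rule SetOf_in_nu)
    have "conn i k (zero_elt i) = zero_elt k" if "k \<le> i" for k
      using that
    proof (induction k rule: less_induct)
      case (less k)
      show ?case
      proof (cases "limit_ord k")
        case True
        then have "(if l < k then Some (conn i l (zero_elt i)) else None) =
            (if l < k then Some (zero_elt l) else None)" for l
          using less by auto
        then show ?thesis
          using True False by (simp add: conn_to_limit zero_elt.simps[of k])
      next
        case k: False
        show ?thesis
          using conn_succ[OF False k in_nu] elems_SetOf_Pow_less[OF empty] k
          by (simp add: eq zero_elt.simps[of k])
      qed
    qed
    with in_nu show ?thesis by blast
  qed
qed

lemma beh_in_nu: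
  fixes \<kappa> :: "'o::wellorder"
  assumes "branching_less \<kappa> R"
  shows "beh R i x \<in> nu \<kappa> i \<and> (\<forall>k\<le>i. conn i k (beh R i x) = beh R k x)"
proof (induction i arbitrary: x rule: less_induct)
  case (less i)
  show ?case
  proof (cases "limit_ord i")
    case True
    let ?f = "\<lambda>j. if j < i then Some (beh R j x) else None"
    have eq: "beh R i x = Fam ?f" using True by (subst beh.simps) simp
    have "beh R i x \<in> nu \<kappa> i"
      unfolding eq using True less by (intro Fam_in_nu) auto
    moreover have "conn i k (beh R i x) = beh R k x" if "k \<le> i" for k
      using that True eq by (cases "k = i") (auto simp: conn_limit)
    ultimately show ?thesis by blast
  next
    case False
    let ?A = "beh R (pred_ord i) ` (R `` {x})"
    have eq: "beh R i x = SetOf ?A" using False by (subst beh.simps) simp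
    have A: "?A \<in> Pow_less \<kappa> (nu \<kappa> (pred_ord i))"
      using assms less pred_ord(1)[OF False]
      by (intro Pow_less_image[of _ _ UNIV] subsetI CollectI)
        (auto simp: Pow_less_def branching_less_def)
    have in_nu: "beh R i x \<in> nu \<kappa> i"
      unfolding eq using False A by (rule SetOf_in_nu)
    have "conn i k (beh R i x) = beh R k x" if "k \<le> i" for k
      using that
    proof (induction k rule: less_induct)
      case k_less: (less k)
      show ?case
      proof (cases "limit_ord k")
        case True
        then have "(if l < k then Some (conn i l (beh R i x)) else None) =
            (if l < k then Some (beh R l x) else None)" for l
          using k_less by auto
        then show ?thesis
          using True False by (simp add: conn_to_limit beh.simps[of R k])
      next
        case k: False
        have pk: "pred_ord k \<le> pred_ord i"
          using pred_ord[OF False] pred_ord[OF k] k_less.prems by auto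
        have "conn i k (beh R i x) = SetOf (conn (pred_ord i) (pred_ord k) ` ?A)"
          using conn_succ[OF False k in_nu] elems_SetOf_Pow_less[OF A] by (simp add: eq)
        also have "conn (pred_ord i) (pred_ord k) ` ?A = beh R (pred_ord k) ` (R `` {x})"
          unfolding image_image using less[OF pred_ord(1)[OF False]] pk
          by (intro image_cong) auto
        also have "SetOf \<dots> = beh R k x"
          using k by (simp add: beh.simps[of R k])
        finally show ?thesis .
      qed
    qed
    with in_nu show ?thesis by blast
  qed
qed

lemma card_of_reachable:
  assumes "Cinfinite \<kappa>" "\<And>y. |R `` {y}| <o \<kappa>"
  shows "|R\<^sup>* `` {x}| \<le>o \<kappa>"
proof -
  have inf: "\<not> finite (Field \<kappa>)" and co: "Card_order \<kappa>"
    using assms(1) by (auto simp: cinfinite_def)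
  have level: "|(R ^^ n) `` {x}| \<le>o \<kappa>" for n
  proof (induction n)
    case 0
    have "finite (Field |(R ^^ 0) `` {x}| )"
      unfolding Field_card_of by simp
    then have "|(R ^^ 0) `` {x}| <o \<kappa>"
      using inf co
      by (intro finite_ordLess_infinite card_of_Well_order) (auto simp: card_order_on_def)
    then show ?case by (rule ordLess_imp_ordLeq)
  next
    case (Suc n)
    have "(R ^^ Suc n) `` {x} = (\<Union>y \<in> (R ^^ n) `` {x}. R `` {y})" by auto
    also have "|\<dots>| \<le>o \<kappa>"
      using inf co Suc assms(2)
      by (intro card_of_UNION_ordLeq_infinite_Field) (auto intro: ordLess_imp_ordLeq)
    finally show ?case .
  qed
  have nat: "|UNIV :: nat set| \<le>o \<kappa>"
    using inf co by (meson infinite_iff_card_of_nat card_of_Field_ordIso ordLeq_ordIso_trans)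
  have "R\<^sup>* `` {x} = (\<Union>n \<in> UNIV. (R ^^ n) `` {x})"
    by (auto simp: rtrancl_power)
  also have "|\<dots>| \<le>o \<kappa>"
    using inf co nat level by (intro card_of_UNION_ordLeq_infinite_Field) auto
  finally show ?thesis .
qed

theorem coalgebraic_beh:
  fixes \<kappa> :: "'o::wellorder" and R :: "'s rel"
  assumes inf: "Cinfinite (ord_rel \<kappa>)" and R: "branching_less \<kappa> R"
  shows "coalgebraic \<kappa> i (beh R i x)"
proof -
  let ?S = "R\<^sup>* `` {x}"
  have "|?S| \<le>o ord_rel \<kappa>"
    using R unfolding branching_less_def by (intro card_of_reachable[OF inf]) blast
  also have "ord_rel \<kappa> =o |Field (ord_rel \<kappa>)|"
    using inf by (simp add: card_of_Field_ordIso ordIso_symmetric)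
  also have "|Field (ord_rel \<kappa>)| \<le>o |UNIV :: 'o set|"
    by (rule card_of_mono1) simp
  finally obtain e :: "'s \<Rightarrow> 'o" where e: "inj_on e ?S"
    by (auto simp: card_of_ordLeq[symmetric])
  define R' where "R' = {(e y, e z) |y z. y \<in> ?S \<and> (y, z) \<in> R}"
  have succs: "R' `` {e y} = e ` (R `` {y})" if "y \<in> ?S" for y
    using that e by (force simp: R'_def inj_on_def)
  have "beh R' i (e y) = beh R i y" if "y \<in> ?S" for i y
    using that
  proof (induction i arbitrary: y rule: less_induct)
    case (less i)
    show ?case
    proof (cases "limit_ord i")
      case True
      have "(if j < i then Some (beh R' j (e y)) else None) =
          (if j < i then Some (beh R j y) else None)" for j
        using less by auto
      with True show ?thesis by (simp add: beh.simps[of _ i])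
    next
      case False
      have "beh R' (pred_ord i) ` (R' `` {e y}) = beh R (pred_ord i) ` (R `` {y})"
        unfolding succs[OF less.prems] image_image
        using less pred_ord(1)[OF False]
        by (intro image_cong) (auto intro: rtrancl_into_rtrancl)
      with False show ?thesis by (simp add: beh.simps[of _ i])
    qed
  qed
  from this[of x i] have eq: "beh R i x = beh R' i (e x)" by simp
  have "|R' `` {u}| <o ord_rel \<kappa>" for u
  proof (cases "u \<in> e ` ?S")
    case True
    then obtain y where y: "u = e y" "y \<in> ?S" by blast
    have "|R `` {y}| <o ord_rel \<kappa>" using R by (simp add: branching_less_def)
    then show ?thesis
      unfolding y(1) succs[OF y(2)] by (rule ordLeq_ordLess_trans[OF card_of_image])
  next
    case False
    then have "R' `` {u} = {}" by (auto simp: R'_def)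
    also have "|{} :: 'o set| <o ord_rel \<kappa>"
      using R ordLeq_ordLess_trans[OF card_of_empty] by (auto simp: branching_less_def)
    finally show ?thesis .
  qed
  then have "branching_less \<kappa> R'" by (simp add: branching_less_def)
  moreover have "beh R i x \<in> nu \<kappa> i" using beh_in_nu[OF R] by simp
  ultimately show ?thesis
    unfolding coalgebraic_def using eq by blast
qed

theorem tree_property_full_branch:
  fixes \<kappa> :: "'o::wellorder" and D :: "'o \<Rightarrow> 't set"
  assumes tp: "tree_property \<kappa>" and tree: "tidy_tree \<kappa> D d"
    and small: "\<And>i. i < \<kappa> \<Longrightarrow> |D i| <o ord_rel \<kappa>"
  shows "\<exists>x. full_branch D d {..<\<kappa>} x"
proof -
  have "\<exists>e :: 't \<Rightarrow> 'o. inj_on e (D i)" if "i < \<kappa>" for i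
    using ordLess_ord_rel_imp[OF small[OF that]] by (auto simp: card_of_ordLeq[symmetric])
  then obtain e :: "'o \<Rightarrow> 't \<Rightarrow> 'o" where e: "\<And>i. i < \<kappa> \<Longrightarrow> inj_on (e i) (D i)"
    by metis
  define r where "r = (\<lambda>i. inv_into (D i) (e i))"
  have r: "r i (e i x) = x" if "i < \<kappa>" "x \<in> D i" for i x
    using that e by (simp add: r_def)
  define D' where "D' = (\<lambda>i. e i ` D i)"
  define d' where "d' = (\<lambda>i j y. e j (d i j (r i y)))"
  have d_in: "d i j x \<in> D j" if "i < \<kappa>" "j \<le> i" "x \<in> D i" for i j x
    using tree that unfolding tidy_tree_def by blast
  have branch: "full_branch D d I (\<lambda>i. r i (x i))"
    if "full_branch D' d' I x" "I \<subseteq> {..<\<kappa>}" for I x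
    unfolding full_branch_def
  proof (intro conjI ballI impI)
    have *: "r i (x i) \<in> D i \<and> e i (r i (x i)) = x i" if "i \<in> I" for i
      using \<open>full_branch D' d' I x\<close> \<open>I \<subseteq> {..<\<kappa>}\<close> that r
      unfolding full_branch_def D'_def by fastforce
    then show "r i (x i) \<in> D i" if "i \<in> I" for i using that by blast
    fix i j assume ij: "i \<in> I" "j \<in> I" "j \<le> i"
    then have "i < \<kappa>" "j < \<kappa>" using \<open>I \<subseteq> {..<\<kappa>}\<close> by auto
    have "x j = e j (d i j (r i (x i)))"
      using \<open>full_branch D' d' I x\<close> ij unfolding full_branch_def d'_def by metis
    then show "d i j (r i (x i)) = r j (x j)"
      using r[OF \<open>j < \<kappa>\<close> d_in[OF \<open>i < \<kappa>\<close> \<open>j \<le> i\<close>]] *[OF \<open>i \<in> I\<close>] by metis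
  qed
  have "tidy_tree \<kappa> D' d'"
    unfolding tidy_tree_def
  proof (intro conjI allI impI ballI)
    fix i x assume "i < \<kappa>" "x \<in> D' i"
    then show "d' i i x = x"
      using tree by (auto simp: D'_def d'_def r tidy_tree_def)
  next
    fix i j k x assume "i < \<kappa>" "j \<le> i" "k \<le> j" "x \<in> D' i"
    then show "d' j k (d' i j x) = d' i k x"
      using tree d_in by (auto simp: D'_def d'_def r tidy_tree_def)
  next
    fix i j assume *: "i < \<kappa>" "j \<le> i"
    have "d' i j ` D' i = e j ` (d i j ` D i)"
      unfolding D'_def d'_def image_image using * by (intro image_cong) (auto simp: r)
    also have "d i j ` D i = D j" using tree * by (auto simp: tidy_tree_def)
    finally show "d' i j ` D' i = D' j" by (simp add: D'_def)
  next
    fix i x assume i: "i < \<kappa>" "limit_ord i" and x: "full_branch D' d' {..<i} x"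
    define z where "z = (\<lambda>i. r i (x i))"
    have z: "full_branch D d {..<i} z"
      unfolding z_def using x i by (intro branch) auto
    show "\<exists>\<^sub>\<le>\<^sub>1 y. full_branch D' d' {..i} (x(i := y))"
    proof (rule Uniq_I)
      fix y y' assume y: "full_branch D' d' {..i} (x(i := y))" "full_branch D' d' {..i} (x(i := y'))"
      have zy: "full_branch D d {..i} (z(i := r i y))"
        if "full_branch D' d' {..i} (x(i := y))" for y
      proof -
        have "full_branch D d {..i} (\<lambda>j. r j ((x(i := y)) j))"
          using that by (rule branch) (use i in auto)
        also have "(\<lambda>j. r j ((x(i := y)) j)) = z(i := r i y)"
          by (auto simp: z_def)
        finally show ?thesis .
      qed
      have "r i y = r i y'"
      proof -
        have "\<exists>\<^sub>\<le>\<^sub>1 y. full_branch D d {..i} (z(i := y))"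
          using tree i z unfolding tidy_tree_def by simp
        then show ?thesis using zy[OF y(1)] zy[OF y(2)] by (rule Uniq_D)
      qed
      moreover have "y \<in> D' i" "y' \<in> D' i"
        using y unfolding full_branch_def by (metis atMost_iff fun_upd_same order_refl)+
      ultimately show "y = y'"
        using i by (auto simp: D'_def r)
    qed
  next
    show "is_singleton (D' (LEAST i. True))"
      using tree by (auto simp: tidy_tree_def is_singleton_def D'_def)
  qed
  moreover have "|D' i| <o ord_rel \<kappa>" if "i < \<kappa>" for i
    unfolding D'_def using small[OF that] by (rule ordLeq_ordLess_trans[OF card_of_image])
  ultimately obtain x where "full_branch D' d' {..<\<kappa>} x"
    using tp unfolding tree_property_def by blast
  then show ?thesis using branch by blast
qed

end

(* Given a tree D with levels below \<kappa> and no full branch, label its nodes injectively by ordinals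
   below \<kappa> so that a node of level i has a label \<ge> i.  Consider the transition system in which
   an ordinal steps to all smaller ordinals, a node to the labels of its ancestors and itself, and
   a root for level i to the nodes of level i.  Stage j tells the ordinals below j apart and identifies
   all others, so the behaviour of the root for level i at stage j \<le> i does not depend on i; these
   behaviours form a Cauchy element a.  A successor of a is at each stage the behaviour of some node.
   By regularity the labels of a given level are bounded, so a late enough stage shows the ancestor
   on that level, and these ancestors form a full branch of D. *)

theory Submission
  imports Defs
begin

section \<open>Cardinality and boundedness below a regular cardinal\<close>

lemma card_of_atMost_less:
  assumes "Cinfinite (ord_rel \<kappa>)" "j < (\<kappa>::'o::wellorder)"
  shows "|{..j}| <o ord_rel \<kappa>"
proof -
  have co: "Card_order (ord_rel \<kappa>)" and inf: "infinite (Field (ord_rel \<kappa>))"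
    using assms(1) by (auto simp: cinfinite_def)
  have "|underS (ord_rel \<kappa>) j| <o ord_rel \<kappa>"
    using co assms(2) by (intro card_of_underS) (auto simp: Field_ord_rel)
  also have "underS (ord_rel \<kappa>) j = {..<j}"
    using assms(2) by (auto simp: underS_def ord_rel_def)
  finally have "|{..<j}| <o ord_rel \<kappa>" .
  moreover have "|{j}| <o ord_rel \<kappa>"
    using inf co by (intro finite_ordLess_infinite card_of_Well_order)
      (auto simp: card_order_on_def Field_card_of)
  ultimately have "|{..<j} \<union> {j}| <o ord_rel \<kappa>"
    using inf co by (intro card_of_Un_ordLess_infinite_Field)
  also have "{..<j} \<union> {j} = {..j}" by auto
  finally show ?thesis .
qed

lemma card_of_lessThan:
  assumes "Cinfinite (ord_rel (\<kappa>::'o::wellorder))"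
  shows "|{..<\<kappa>}| =o ord_rel \<kappa>"
  using assms card_of_Field_ordIso[of "ord_rel \<kappa>"] by (simp add: Field_ord_rel)

text \<open>If \<kappa> had a predecessor \<open>j\<close>, then \<open>{..<\<kappa>}\<close> would
  equal \<open>{..j}\<close>, which is too small.\<close>

lemma limit_ord_of_Cinfinite:
  assumes "Cinfinite (ord_rel (\<kappa>::'o::wellorder))"
  shows "limit_ord \<kappa>"
proof (rule ccontr)
  assume "\<not> limit_ord \<kappa>"
  note pred = pred_ord[OF this]
  then have "{..pred_ord \<kappa>} = {..<\<kappa>}" by fastforce
  then have "|{..<\<kappa>}| <o ord_rel \<kappa>"
    using card_of_atMost_less[OF assms pred(1)] by simp
  then show False
    using card_of_lessThan[OF assms] not_ordLess_ordIso by blast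
qed

text \<open>Since \<open>cofinal\<close> asks for strictly larger elements, its failure gives a
  bound that may itself lie in \<open>A\<close>. Where a strict bound is wanted,
  \<open>succ_ord\<close> has to be applied.\<close>

lemma regular_bounded:
  assumes "regularCard (ord_rel (\<kappa>::'o::wellorder))" "A \<subseteq> {..<\<kappa>}" "|A| <o ord_rel \<kappa>"
  obtains m where "m < \<kappa>" "\<And>x. x \<in> A \<Longrightarrow> x \<le> m"
proof -
  have "\<not> |A| =o ord_rel \<kappa>" using assms(3) not_ordLess_ordIso by blast
  then have "\<not> cofinal A (ord_rel \<kappa>)"
    using assms(1,2) by (auto simp: regularCard_def Field_ord_rel)
  then obtain m where "m < \<kappa>" "\<forall>b\<in>A. m = b \<or> (m, b) \<notin> ord_rel \<kappa>"
    by (auto simp: cofinal_def Field_ord_rel)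
  with assms(2) that show thesis by (fastforce simp: ord_rel_def)
qed

text \<open>An injection of the product of all nodes with \<kappa> into \<kappa> offers each node
  \<kappa> many candidate labels. They cannot all fit below its level, an initial segment of size
  less than \<kappa>, so a large enough one can be chosen. Distinct nodes have disjoint sets of
  candidates, so any choice is injective.\<close>

lemma increasing_enumeration:
  fixes \<kappa> :: "'o::wellorder" and D :: "'o \<Rightarrow> 't set"
  assumes inf: "Cinfinite (ord_rel \<kappa>)" and small: "\<And>i. i < \<kappa> \<Longrightarrow> |D i| <o ord_rel \<kappa>"
  obtains e :: "'o \<times> 't \<Rightarrow> 'o" where "inj_on e (Sigma {..<\<kappa>} D)"
    "\<And>i x. i < \<kappa> \<Longrightarrow> x \<in> D i \<Longrightarrow> i \<le> e (i, x) \<and> e (i, x) < \<kappa>"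
proof -
  let ?T = "Sigma {..<\<kappa>} D"
  have co: "Card_order (ord_rel \<kappa>)" and infF: "infinite (Field (ord_rel \<kappa>))"
    using inf by (auto simp: cinfinite_def)
  have le: "|{..<\<kappa>}| \<le>o ord_rel \<kappa>"
    using card_of_lessThan[OF inf] by (rule ordIso_imp_ordLeq)
  have "|?T| \<le>o ord_rel \<kappa>"
    using infF co le small
    by (intro card_of_Sigma_ordLeq_infinite_Field) (auto intro: ordLess_imp_ordLeq)
  then have "|?T \<times> {..<\<kappa>}| \<le>o ord_rel \<kappa>"
    by (rule card_of_Sigma_ordLeq_infinite_Field[OF infF co]) (simp add: le)
  then have "|?T \<times> {..<\<kappa>}| \<le>o |{..<\<kappa>}|"
    using card_of_lessThan[OF inf] ordIso_symmetric ordLeq_ordIso_trans by blast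
  then obtain g where g: "inj_on g (?T \<times> {..<\<kappa>})" "g ` (?T \<times> {..<\<kappa>}) \<subseteq> {..<\<kappa>}"
    by (auto simp: card_of_ordLeq[symmetric])
  have "\<exists>v<\<kappa>. fst t \<le> g (t, v)" if "t \<in> ?T" for t
  proof (rule ccontr)
    assume "\<not> ?thesis"
    then have "(\<lambda>v. g (t, v)) ` {..<\<kappa>} \<subseteq> {..fst t}" by fastforce
    moreover have "inj_on (\<lambda>v. g (t, v)) {..<\<kappa>}"
      using g(1) that by (auto simp: inj_on_def)
    ultimately have "|{..<\<kappa>}| \<le>o |{..fst t}|"
      by (metis card_of_ordLeq)
    also have "|{..fst t}| <o ord_rel \<kappa>"
      using that by (intro card_of_atMost_less[OF inf]) auto
    finally show False
      using card_of_lessThan[OF inf] not_ordLess_ordIso by blast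
  qed
  then obtain v where v: "\<And>t. t \<in> ?T \<Longrightarrow> v t < \<kappa> \<and> fst t \<le> g (t, v t)"
    by metis
  show thesis
  proof
    show "inj_on (\<lambda>t. g (t, v t)) ?T"
    proof (rule inj_onI)
      fix s t assume st: "s \<in> ?T" "t \<in> ?T" "g (s, v s) = g (t, v t)"
      have "(s, v s) = (t, v t)"
        using st v[OF st(1)] v[OF st(2)] by (intro inj_onD[OF g(1)]) auto
      then show "s = t" by (rule Pair_inject)
    qed
    show "i \<le> g ((i, x), v (i, x)) \<and> g ((i, x), v (i, x)) < \<kappa>" if "i < \<kappa>" "x \<in> D i" for i x
    proof -
      have "(i, x) \<in> ?T" using that by simp
      note v = v[OF this]
      have "g ((i, x), v (i, x)) \<in> g ` (?T \<times> {..<\<kappa>})"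
        using that v by (intro imageI) simp
      with g(2) v show ?thesis by auto
    qed
  qed
qed

section \<open>The transition system of a labelled tree\<close>

datatype ('o, 't) state = Ord 'o | Node 'o 't | Root 'o

locale tree_system =
  fixes \<kappa> :: "'o::wellorder" and D :: "'o \<Rightarrow> 't set" and d :: "'o \<Rightarrow> 'o \<Rightarrow> 't \<Rightarrow> 't"
    and e :: "'o \<times> 't \<Rightarrow> 'o"
  assumes inf: "Cinfinite (ord_rel \<kappa>)"
    and regular: "regularCard (ord_rel \<kappa>)"
    and small: "\<And>i. i < \<kappa> \<Longrightarrow> |D i| <o ord_rel \<kappa>"
    and d_comp: "\<And>i j k x. i < \<kappa> \<Longrightarrow> j \<le> i \<Longrightarrow> k \<le> j \<Longrightarrow> x \<in> D i \<Longrightarrow> d j k (d i j x) = d i k x"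
    and d_surj: "\<And>i j. i < \<kappa> \<Longrightarrow> j \<le> i \<Longrightarrow> d i j ` D i = D j"
    and D_nonempty: "\<And>i. i < \<kappa> \<Longrightarrow> D i \<noteq> {}"
    and e_inj: "inj_on e (Sigma {..<\<kappa>} D)"
    and e_ge: "\<And>i x. i < \<kappa> \<Longrightarrow> x \<in> D i \<Longrightarrow> i \<le> e (i, x)"
    and e_less: "\<And>i x. i < \<kappa> \<Longrightarrow> x \<in> D i \<Longrightarrow> e (i, x) < \<kappa>"
begin

text \<open>The \<open>Ord\<close> states imitate von Neumann ordinals. Indices outside \<kappa> get
  no successors, so that fewer than \<kappa> successors occur at every state of the type.\<close>

primrec succs :: "('o, 't) state \<Rightarrow> ('o, 't) state set" where
  "succs (Ord \<alpha>) = (if \<alpha> < \<kappa> then Ord ` {..<\<alpha>} else {})"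
| "succs (Node i x) = (if i < \<kappa> then (\<lambda>k. Ord (e (k, d i k x))) ` {..i} else {})"
| "succs (Root i) = (if i < \<kappa> then Node i ` D i else {})"

definition R :: "('o, 't) state rel" where
  "R = Sigma UNIV succs"

lemma R_Image: "R `` {s} = succs s"
  by (auto simp: R_def)

lemma d_in: "i < \<kappa> \<Longrightarrow> j \<le> i \<Longrightarrow> x \<in> D i \<Longrightarrow> d i j x \<in> D j"
  using d_surj by blast

lemma limit: "limit_ord \<kappa>"
  using inf by (rule limit_ord_of_Cinfinite)

lemma succ_less: "j < \<kappa> \<Longrightarrow> succ_ord j < \<kappa>"
  using limit succ_ord(2) unfolding limit_ord_def by (meson le_less_trans)

lemma branching: "branching_less \<kappa> R"
  unfolding branching_less_def R_Image
proof
  have empty: "|{} :: ('o, 't) state set| <o ord_rel \<kappa>"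
  proof -
    have "\<kappa> \<noteq> (LEAST i. True) \<longrightarrow> (LEAST i. True) < \<kappa>"
      by (simp add: Least_le le_neq_trans)
    moreover have "{..<\<kappa>} \<noteq> {}"
      using inf by (metis Field_ord_rel cinfinite_def finite.emptyI)
    ultimately obtain j where "j < \<kappa>" by auto
    from card_of_atMost_less[OF inf this] show ?thesis
      by (rule ordLeq_ordLess_trans[OF card_of_empty])
  qed
  fix s :: "('o, 't) state"
  show "|succs s| <o ord_rel \<kappa>"
  proof (cases s)
    case (Ord \<alpha>)
    show ?thesis
    proof (cases "\<alpha> < \<kappa>")
      case True
      have "|succs s| \<le>o |{..<\<alpha>}|" using Ord True by (simp add: card_of_image)
      also have "|{..<\<alpha>}| \<le>o |{..\<alpha>}|" by (rule card_of_mono1) auto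
      also have "|{..\<alpha>}| <o ord_rel \<kappa>" using inf True by (rule card_of_atMost_less)
      finally show ?thesis .
    qed (use Ord empty in simp)
  next
    case (Node i x)
    show ?thesis
    proof (cases "i < \<kappa>")
      case True
      then show ?thesis
        unfolding Node succs.simps if_P[OF True]
        by (intro ordLeq_ordLess_trans[OF card_of_image card_of_atMost_less[OF inf]])
    qed (use Node empty in simp)
  next
    case (Root i)
    show ?thesis
    proof (cases "i < \<kappa>")
      case True
      then show ?thesis
        unfolding Root succs.simps if_P[OF True]
        by (intro ordLeq_ordLess_trans[OF card_of_image small])
    qed (use Root empty in simp)
  qed
qed

section \<open>What a given stage can distinguish\<close>

lemma conn_beh: "k \<le> (i::'o) \<Longrightarrow> conn i k (beh R i s) = beh R k s"
  using beh_in_nu[OF branching] by blast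

lemma beh_succ: "j < \<kappa> \<Longrightarrow> beh R (succ_ord j) s = SetOf (beh R j ` succs s)"
  using succ_ord(3,4)[of j \<kappa>] by (simp add: beh.simps[of _ "succ_ord j"] R_Image)

lemma beh_limit: "limit_ord i \<Longrightarrow> beh R i s = Fam (\<lambda>j. if j < i then Some (beh R j s) else None)"
  by (subst beh.simps) simp

lemma elems_beh_succ:
  assumes "j < \<kappa>"
  shows "elems (beh R (succ_ord j) s) = beh R j ` succs s"
proof -
  \<comment> \<open>Only the size of the set matters for \<open>elems\<close> to undo
    \<open>SetOf\<close>, hence the ambient \<open>UNIV\<close>.\<close>
  have "beh R j ` succs s \<in> Pow_less \<kappa> UNIV"
    using branching ordLeq_ordLess_trans[OF card_of_image]
    by (auto simp: Pow_less_def branching_less_def R_Image)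
  with assms show ?thesis
    by (simp add: beh_succ elems_SetOf_Pow_less)
qed

lemma beh_Ord_eq: "i \<le> \<alpha> \<Longrightarrow> i \<le> \<beta> \<Longrightarrow> \<alpha> < \<kappa> \<Longrightarrow> \<beta> < \<kappa> \<Longrightarrow> beh R i (Ord \<alpha>) = beh R i (Ord \<beta>)"
proof (induction i arbitrary: \<alpha> \<beta> rule: less_induct)
  case (less i)
  show ?case
  proof (cases "limit_ord i")
    case True
    have "(if j < i then Some (beh R j (Ord \<alpha>)) else None) =
        (if j < i then Some (beh R j (Ord \<beta>)) else None)" for j
      using less.IH[of j \<alpha> \<beta>] less.prems by simp
    with True show ?thesis by (simp add: beh_limit)
  next
    case False
    define j where "j = pred_ord i"
    have "j < i" using pred_ord(1)[OF False] by (simp add: j_def)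
    \<comment> \<open>By induction every ordinal above \<open>j\<close> looks like \<open>j\<close>
      at stage \<open>j\<close>, so the members coming from such ordinals are already supplied by
      \<open>Ord j\<close>.\<close>
    have img: "beh R j ` Ord ` {..<\<gamma>} = beh R j ` Ord ` {..j}" if "i \<le> \<gamma>" "\<gamma> < \<kappa>" for \<gamma>
    proof (intro equalityI subsetI)
      fix z assume "z \<in> beh R j ` Ord ` {..<\<gamma>}"
      then obtain \<delta> where "\<delta> < \<gamma>" "z = beh R j (Ord \<delta>)" by auto
      moreover have "beh R j (Ord \<delta>) = beh R j (Ord j)" if "j < \<delta>"
        using less.IH[OF \<open>j < i\<close>, of \<delta> j] that \<open>\<delta> < \<gamma>\<close> \<open>\<gamma> < \<kappa>\<close> by simp
      ultimately show "z \<in> beh R j ` Ord ` {..j}"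
        by (cases "j < \<delta>") auto
    qed (use that \<open>j < i\<close> in auto)
    show ?thesis
      using False img[of \<alpha>] img[of \<beta>] less.prems
      by (simp add: beh.simps[of _ i] R_Image flip: j_def)
  qed
qed

text \<open>Stage \<open>succ_ord \<alpha>\<close> already separates the two: \<alpha> is a
  successor of \<beta>, and if some \<gamma> below \<alpha> looked like \<alpha> at stage \<alpha>,
  the induction hypothesis for \<gamma> would be violated.\<close>

lemma beh_Ord_neq: "\<alpha> < i \<Longrightarrow> \<alpha> < \<beta> \<Longrightarrow> \<beta> < \<kappa> \<Longrightarrow> beh R i (Ord \<alpha>) \<noteq> beh R i (Ord \<beta>)"
proof (induction \<alpha> arbitrary: i \<beta> rule: less_induct)
  case (less \<alpha>)
  have "\<alpha> < \<kappa>" using less.prems by simp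
  show ?case
  proof
    assume "beh R i (Ord \<alpha>) = beh R i (Ord \<beta>)"
    then have "beh R (succ_ord \<alpha>) (Ord \<alpha>) = beh R (succ_ord \<alpha>) (Ord \<beta>)"
      using conn_beh succ_ord(2)[OF less.prems(1)] by metis
    then have "beh R \<alpha> ` succs (Ord \<alpha>) = beh R \<alpha> ` succs (Ord \<beta>)"
      using elems_beh_succ[OF \<open>\<alpha> < \<kappa>\<close>] by metis
    moreover have "beh R \<alpha> (Ord \<alpha>) \<in> beh R \<alpha> ` succs (Ord \<beta>)"
      using less.prems by simp
    ultimately have "beh R \<alpha> (Ord \<alpha>) \<in> beh R \<alpha> ` succs (Ord \<alpha>)"
      by simp
    then obtain \<gamma> where "\<gamma> < \<alpha>" "beh R \<alpha> (Ord \<gamma>) = beh R \<alpha> (Ord \<alpha>)"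
      using \<open>\<alpha> < \<kappa>\<close> by auto
    then show False using less.IH[of \<gamma> \<alpha> \<alpha>] \<open>\<alpha> < \<kappa>\<close> by simp
  qed
qed

text \<open>One ordinal below the stage is enough, because the smaller of the two is then below it
  as well. This allows a comparison with a label about which no bound is known.\<close>

lemma beh_Ord_inj:
  assumes "beh R i (Ord \<alpha>) = beh R i (Ord \<beta>)" "\<alpha> < i" "\<alpha> < \<kappa>" "\<beta> < \<kappa>"
  shows "\<alpha> = \<beta>"
  using assms beh_Ord_neq[of \<alpha> i \<beta>] beh_Ord_neq[of \<beta> i \<alpha>] by (metis less_linear less_trans)

text \<open>The labels of the nodes above level \<open>j\<close> are at least \<open>j\<close>, so at stage \<open>j\<close> they all look alike.\<close>

lemma beh_Node_succ:
  assumes "j \<le> i" "i < \<kappa>" "x \<in> D i"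
  shows "beh R (succ_ord j) (Node i x) = beh R (succ_ord j) (Node j (d i j x))"
proof -
  have "j < \<kappa>" using assms by simp
  have in_D: "d i k x \<in> D k" if "k \<le> i" for k using d_in that assms by blast
  let ?f = "\<lambda>k. beh R j (Ord (e (k, d i k x)))"
  have collapse: "?f k = ?f j" if "j \<le> k" "k \<le> i" for k
    using that assms \<open>j < \<kappa>\<close> in_D e_ge e_less
    by (intro beh_Ord_eq) (meson le_less_trans order_trans)+
  have "?f ` {..i} = ?f ` {..j}"
  proof (intro equalityI subsetI)
    fix u assume "u \<in> ?f ` {..i}"
    then obtain k where "k \<le> i" "u = ?f k" by auto
    then show "u \<in> ?f ` {..j}"
      using collapse[of k] by (cases "k \<le> j") auto
  qed (use assms in auto)
  then have "beh R j ` succs (Node i x) = beh R j ` (\<lambda>k. Ord (e (k, d i k x))) ` {..j}"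
    using assms by (simp add: image_image)
  also have "(\<lambda>k. Ord (e (k, d i k x))) ` {..j} = succs (Node j (d i j x))"
    using assms \<open>j < \<kappa>\<close> by (simp add: d_comp)
  finally show ?thesis
    using \<open>j < \<kappa>\<close> by (simp add: beh_succ)
qed

lemma beh_Node:
  assumes "j \<le> i" "i < \<kappa>" "x \<in> D i"
  shows "beh R j (Node i x) = beh R j (Node j (d i j x))"
proof -
  have "j < \<kappa>" using assms by simp
  then have "j \<le> succ_ord j" by (metis succ_ord(1) less_imp_le)
  then show ?thesis using beh_Node_succ[OF assms] conn_beh by metis
qed

text \<open>At stage \<open>j\<close> the nodes of level \<open>i\<close> look like their ancestors
  on level \<open>j\<close>, and by surjectivity these ancestors are all of \<open>D j\<close>.
  Agreement at \<open>succ_ord j\<close>, one stage beyond \<open>j\<close>, is what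
  \<open>elems_spectre\<close> relies on.\<close>

lemma beh_Root_succ:
  assumes "j \<le> i" "i < \<kappa>"
  shows "beh R (succ_ord j) (Root i) = beh R (succ_ord j) (Root j)"
proof -
  have "j < \<kappa>" using assms by simp
  have "beh R j ` succs (Root i) = (\<lambda>x. beh R j (Node j (d i j x))) ` D i"
    using assms by (simp add: image_image beh_Node)
  also have "\<dots> = beh R j ` Node j ` d i j ` D i" by (simp add: image_image)
  also have "\<dots> = beh R j ` succs (Root j)"
    using \<open>j < \<kappa>\<close> assms by (simp add: d_surj)
  finally show ?thesis
    using \<open>j < \<kappa>\<close> by (simp add: beh_succ)
qed

lemma beh_Root:
  assumes "j \<le> i" "i < \<kappa>"
  shows "beh R j (Root i) = beh R j (Root j)"
proof -
  have "j < \<kappa>" using assms by simp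
  then have "j \<le> succ_ord j" by (metis succ_ord(1) less_imp_le)
  then show ?thesis using beh_Root_succ[OF assms] conn_beh by metis
qed

section \<open>The ghost, and why a successor of it would give a full branch\<close>

text \<open>A diagonal choice: each component comes from a different root. By
  \<open>beh_Root\<close> any root of a later level below \<kappa> would give the same
  component.\<close>

definition spectre :: "'o elt" where
  "spectre = Fam (\<lambda>j. if j < \<kappa> then Some (beh R j (Root j)) else None)"

lemma component_spectre: "j < \<kappa> \<Longrightarrow> component spectre j = beh R j (Root j)"
  by (simp add: spectre_def)

lemma spectre_in_nu: "spectre \<in> nu \<kappa> \<kappa>"
  unfolding spectre_def
proof (rule Fam_in_nu[OF limit])
  show "beh R j (Root j) \<in> nu \<kappa> j" for j
    using beh_in_nu[OF branching] by blast
  show "conn j k (beh R j (Root j)) = beh R k (Root k)" if "j < \<kappa>" "k \<le> j" for j k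
    using that conn_beh beh_Root by metis
qed

text \<open>The states here do not form the type \<open>'o\<close> that \<open>coalgebraic\<close>
  prescribes; \<open>coalgebraic_beh\<close> transfers their behaviours to a relation on
  \<open>'o\<close>.\<close>

lemma Cauchy_spectre: "Cauchy_elt \<kappa> \<kappa> spectre"
  using limit spectre_in_nu coalgebraic_beh[OF inf branching]
  by (simp add: Cauchy_elt_def component_spectre)

text \<open>This component is defined from the root of level \<open>succ_ord j\<close>; trading it
  for \<open>Root j\<close> makes level \<open>j\<close> itself index the members.\<close>

lemma elems_spectre:
  assumes "j < \<kappa>"
  shows "elems (component spectre (succ_ord j)) = beh R j ` Node j ` D j"
proof -
  have "component spectre (succ_ord j) = beh R (succ_ord j) (Root j)"
    using assms succ_less beh_Root_succ[of j "succ_ord j"] succ_ord(1)[OF assms]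
    by (simp add: component_spectre less_imp_le)
  then show ?thesis using assms by (simp add: elems_beh_succ)
qed

lemma spectre_nonzero: "spectre \<noteq> zero_elt \<kappa>"
proof
  assume eq: "spectre = zero_elt \<kappa>"
  have "{..<\<kappa>} \<noteq> {}"
    using inf by (metis Field_ord_rel cinfinite_def finite.emptyI)
  then obtain j where j: "j < \<kappa>" by auto
  have "component spectre (succ_ord j) = zero_elt (succ_ord j)"
    unfolding eq zero_elt.simps[of \<kappa>] using limit succ_less[OF j] by simp
  also have "\<dots> = SetOf {}"
    using succ_ord(3)[OF j] by (simp add: zero_elt.simps[of "succ_ord j"])
  finally have "beh R j ` Node j ` D j = elems (SetOf {} :: 'o elt)"
    using elems_spectre[OF j] by simp
  also have "\<dots> = {}" by (intro elems_SetOf card_of_empty)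
  finally show False using D_nonempty[OF j] by simp
qed

text \<open>The nodes \<open>y j\<close> that represent the components of \<open>b\<close> need not
  be compatible in the tree; only their behaviours are. The branch \<open>z\<close> collects, for
  each level, the ancestor at which they stabilise.\<close>

lemma successor_branch:
  assumes b: "b \<in> nu \<kappa> \<kappa>" "successor \<kappa> spectre b"
  shows "\<exists>z. full_branch D d {..<\<kappa>} z"
proof -
  have "\<forall>j<\<kappa>. \<exists>y\<in>D j. component b j = beh R j (Node j y)"
    using b(2) by (auto simp: successor_def elems_spectre)
  then obtain y where y: "\<And>j. j < \<kappa> \<Longrightarrow> y j \<in> D j"
    and b_eq: "\<And>j. j < \<kappa> \<Longrightarrow> component b j = beh R j (Node j (y j))"
    by metis
  have coherent: "beh R m (Node n (y n)) = beh R m (Node m (y m))" if "m \<le> n" "n < \<kappa>" for m n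
  proof -
    have "conn n m (conn \<kappa> n b) = conn \<kappa> m b"
      using conn_functorial[OF b(1), of n] that by simp
    then have "conn n m (component b n) = component b m"
      using that limit by (simp add: conn_limit)
    then show ?thesis using that by (simp add: b_eq conn_beh)
  qed
  \<comment> \<open>Regularity bounds the labels of a whole level. The bound is strict so that
    \<open>beh_Ord_inj\<close> applies to each of these labels at stage \<open>m\<close>.\<close>
  have "\<exists>m<\<kappa>. k \<le> m \<and> (\<forall>x\<in>D k. e (k, x) < m)" if "k < \<kappa>" for k
  proof -
    have "(\<lambda>x. e (k, x)) ` D k \<subseteq> {..<\<kappa>}" using e_less that by auto
    moreover have "|(\<lambda>x. e (k, x)) ` D k| <o ord_rel \<kappa>"
      using small[OF that] by (rule ordLeq_ordLess_trans[OF card_of_image])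
    ultimately obtain m where m: "m < \<kappa>" "\<And>x. x \<in> D k \<Longrightarrow> e (k, x) \<le> m"
      using regular_bounded[OF regular] by (metis imageI)
    have "e (k, x) < max k (succ_ord m)" if "x \<in> D k" for x
      using m(2)[OF that] succ_ord(1)[OF m(1)] by (meson le_less_trans less_max_iff_disj)
    then show ?thesis
      using m(1) succ_less that by (intro exI[of _ "max k (succ_ord m)"]) simp
  qed
  then obtain B where B: "\<And>k. k < \<kappa> \<Longrightarrow> B k < \<kappa>" "\<And>k. k < \<kappa> \<Longrightarrow> k \<le> B k"
    "\<And>k x. k < \<kappa> \<Longrightarrow> x \<in> D k \<Longrightarrow> e (k, x) < B k"
    by metis
  \<comment> \<open>One stage more than \<open>B k\<close>: the members of a behaviour at stage
    \<open>M k\<close> are behaviours of labels at stage \<open>B k\<close>.\<close>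
  define M where "M k = succ_ord (B k)" for k
  have M: "M k < \<kappa>" "k \<le> M k" if "k < \<kappa>" for k
  proof -
    show "M k < \<kappa>"
      unfolding M_def using that by (intro succ_less B(1))
    have "B k < M k"
      unfolding M_def using B(1)[OF that] by (rule succ_ord(1))
    with B(2)[OF that] show "k \<le> M k" by order
  qed
  define z where "z k = d (M k) k (y (M k))" for k
  \<comment> \<open>The label of \<open>z k\<close> is a successor of the node
    \<open>y (M k)\<close>, so by coherence \<open>y n\<close> has an ancestor, on some level
    \<open>l\<close>, whose label looks the same at stage \<open>B k\<close>. The label of
    \<open>z k\<close> is below \<open>B k\<close>, hence the labels coincide, and injectivity of
    \<open>e\<close> gives both \<open>l = k\<close> and the equality of the nodes.\<close>
  have stable: "d n k (y n) = z k" if k: "k < \<kappa>" and n: "M k \<le> n" "n < \<kappa>" for k n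
  proof -
    have "elems (beh R (M k) (Node (M k) (y (M k)))) = elems (beh R (M k) (Node n (y n)))"
      using coherent[OF n] by (rule arg_cong[OF sym])
    then have eq: "beh R (B k) ` succs (Node (M k) (y (M k))) = beh R (B k) ` succs (Node n (y n))"
      using B(1)[OF k] by (simp add: M_def elems_beh_succ)
    have "Ord (e (k, z k)) \<in> succs (Node (M k) (y (M k)))"
      using M[OF k] by (simp add: z_def)
    then have "beh R (B k) (Ord (e (k, z k))) \<in> beh R (B k) ` succs (Node n (y n))"
      unfolding eq[symmetric] by (rule imageI)
    then obtain l where l: "l \<le> n"
      "beh R (B k) (Ord (e (k, z k))) = beh R (B k) (Ord (e (l, d n l (y n))))"
      using n(2) by auto
    have in_D: "z k \<in> D k" "d n l (y n) \<in> D l"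
      using M[OF k] l(1) n y d_in by (auto simp: z_def)
    have "l < \<kappa>" using l(1) n(2) by simp
    have "e (k, z k) = e (l, d n l (y n))"
      using l(2) in_D B(3) e_less k \<open>l < \<kappa>\<close> by (intro beh_Ord_inj) auto
    then have "(k, z k) = (l, d n l (y n))"
      using in_D k \<open>l < \<kappa>\<close> by (intro inj_onD[OF e_inj]) auto
    then show ?thesis by auto
  qed
  have "full_branch D d {..<\<kappa>} z"
    unfolding full_branch_def
  proof (intro conjI ballI impI)
    show "z i \<in> D i" if "i \<in> {..<\<kappa>}" for i
      using that M y d_in by (simp add: z_def)
    fix i j assume ij: "i \<in> {..<\<kappa>}" "j \<in> {..<\<kappa>}" "j \<le> i"
    \<comment> \<open>Beyond both thresholds, \<open>z i\<close> and \<open>z j\<close> are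
      ancestors of the single node \<open>y n\<close>, hence compatible.\<close>
    define n where "n = max (M i) (M j)"
    have n: "n < \<kappa>" "M i \<le> n" "M j \<le> n" "i \<le> n"
      using ij M(1)[of i] M(1)[of j] M(2)[of i] by (auto simp: n_def le_max_iff_disj)
    have "d i j (z i) = d i j (d n i (y n))" using stable[of i n] ij n by simp
    also have "\<dots> = d n j (y n)" using ij n y by (intro d_comp) auto
    also have "\<dots> = z j" using stable[of j n] ij n by simp
    finally show "d i j (z i) = z j" .
  qed
  then show ?thesis by blast
qed

end

theorem proposition8p7:
  fixes \<kappa> :: "'o::wellorder"
  assumes "Cinfinite (ord_rel \<kappa>)"
    and "regularCard (ord_rel \<kappa>)"
    and "\<not> tree_property \<kappa>"
  shows "\<exists>a. ghost \<kappa> \<kappa> a"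
proof -
  from assms(3) obtain D :: "'o \<Rightarrow> 'o set" and d where tidy: "tidy_tree \<kappa> D d"
    and small: "\<And>i. i < \<kappa> \<Longrightarrow> |D i| <o ord_rel \<kappa>"
    and no_branch: "\<nexists>x. full_branch D d {..<\<kappa>} x"
    unfolding tree_property_def by blast
  obtain e :: "'o \<times> 'o \<Rightarrow> 'o" where e: "inj_on e (Sigma {..<\<kappa>} D)"
    "\<And>i x. i < \<kappa> \<Longrightarrow> x \<in> D i \<Longrightarrow> i \<le> e (i, x) \<and> e (i, x) < \<kappa>"
    using increasing_enumeration[where D = D, OF assms(1) small] by blast
  have surj: "d i j ` D i = D j" if "i < \<kappa>" "j \<le> i" for i j
    using tidy that unfolding tidy_tree_def by blast
  interpret tree_system \<kappa> D d e
  proof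
    \<comment> \<open>Every level maps onto the singleton bottom level, so no level is
      empty.\<close>
    have "D (LEAST i. True) \<noteq> {}"
      using tidy by (auto simp: tidy_tree_def is_singleton_def)
    then show "D i \<noteq> {}" if "i < \<kappa>" for i
      using surj[OF that, of "LEAST i. True"] by (auto simp: Least_le)
    show "d j k (d i j x) = d i k x" if "i < \<kappa>" "j \<le> i" "k \<le> j" "x \<in> D i" for i j k x
      using tidy that unfolding tidy_tree_def by blast
  qed (rule assms(1,2) small surj e(1) e(2)[THEN conjunct1] e(2)[THEN conjunct2]; assumption)+
  show ?thesis
    using Cauchy_spectre spectre_nonzero successor_branch no_branch
    unfolding ghost_def by (intro exI[of _ spectre]) auto
qed

end
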